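(* Suppose $G$ is an $(r,t)$-RS graph on $n$ vertices. Then \[ r \leq \begin{cases} \dfrac{n}{4}\left(1+\dfrac{1}{t}\right) & \text{if $t$ is odd,}\\[2mm] \dfrac{n}{4}\left(1+\dfrac{1}{t+1}\right) & \text{if $t$ is even.} \end{cases} \] Moreover, these upper bounds on $r$ are tight for every positive integer $t$ and infinitely many $n$.
   Context: A graph $G$ is called an $(r,t)$-Ruzsa-Szemerédi graph (or $(r,t)$-RS graph) if its edge set can be partitioned into $t$ pairwise edge-disjoint induced matchings, each consisting of exactly $r$ edges. *)

theory Defs
  imports Complex_Main "HOL-Library.Disjoint_Sets"
begin

definition simple_graph :: "'a set \<Rightarrow> 'a set set \<Rightarrow> bool" where
  "simple_graph V E \<longleftrightarrow> finite V \<and> (\<forall>e\<in>E. e \<subseteq> V \<and> card e = 2)"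

definition induced_edges :: "'a set set \<Rightarrow> 'a set \<Rightarrow> 'a set set" where
  "induced_edges E W = {e \<in> E. e \<subseteq> W}"

definition matching :: "'a set set \<Rightarrow> 'a set set \<Rightarrow> bool" where
  "matching E M \<longleftrightarrow> M \<subseteq> E \<and> disjoint M"

definition induced_matching :: "'a set set \<Rightarrow> 'a set set \<Rightarrow> bool" where
  "induced_matching E M \<longleftrightarrow> matching E M \<and> induced_edges E (\<Union>M) = M"

text \<open>The \<open>t\<close> matchings form an indexed family, so the degenerate case
  \<open>r = 0\<close> (an edgeless graph, all matchings empty) is allowed for every \<open>t\<close>.\<close>

definition rs_graph :: "nat \<Rightarrow> nat \<Rightarrow> 'a set \<Rightarrow> 'a set set \<Rightarrow> bool" where
  "rs_graph r t V E \<longleftrightarrow>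
     simple_graph V E \<and>
     (\<exists>M :: nat \<Rightarrow> 'a set set.
        (\<forall>i<t. induced_matching E (M i) \<and> card (M i) = r) \<and>
        disjoint_family_on M {..<t} \<and>
        (\<Union>i<t. M i) = E)"

definition rs_bound :: "nat \<Rightarrow> nat \<Rightarrow> real" where
  "rs_bound n t =
     (if odd t then real n / 4 * (1 + 1 / real t)
      else real n / 4 * (1 + 1 / (real t + 1)))"

end

theory Submission
  imports Defs
begin

text \<open>Let \<open>A i\<close> be the vertex set of the \<open>i\<close>-th matching, so \<open>|A i| = 2r\<close>. An edge of the \<open>i\<close>-th
  matching cannot lie inside \<open>A j\<close> for \<open>j \<noteq> i\<close>, so \<open>|A i \<inter> A j| \<le> r\<close>. Hence the sets \<open>A i\<close> together
  with the empty set form a binary code of size \<open>t + 1\<close> with minimum distance at least \<open>2r\<close>, and the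
  upper bound is the Plotkin bound.

  Equality holds for the two middle layers of the cube of dimension \<open>2k + 1\<close>, where \<open>k = t div 2\<close>,
  with the edges in direction \<open>i\<close> as the \<open>i\<close>-th matching: an edge in direction \<open>i\<close> has endpoints \<open>S\<close>
  and \<open>insert i S\<close>, whereas the vertices covered by direction \<open>j\<close> contain \<open>j\<close> if they are in the upper
  layer and avoid \<open>j\<close> if they are in the lower one. Each vertex is covered by exactly \<open>k + 1\<close> of the
  \<open>2k + 1\<close> directions, so the code is balanced at every coordinate, as equality in the Plotkin bound
  requires; omitting one direction when \<open>t\<close> is even preserves this. Disjoint copies give infinitely
  many \<open>n\<close>.\<close>

subsection \<open>The Plotkin bound\<close>

lemma mult_diff_le_square_div_4:
  fixes x n :: nat
  assumes "x \<le> n"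
  shows "x * (n - x) \<le> n\<^sup>2 div 4"
proof -
  obtain y where n: "n = x + y" using assms le_Suc_ex by blast
  have "4 * int x * int y \<le> (int x + int y)\<^sup>2"
    using zero_le_power2[of "int x - int y"] by (simp add: power2_eq_square algebra_simps)
  then have "int (x * y * 4) \<le> int (n\<^sup>2)" by (simp add: n algebra_simps)
  then have "x * y * 4 \<le> n\<^sup>2" by (simp only: of_nat_le_iff)
  then show ?thesis by (simp add: n less_eq_div_iff_mult_less_eq)
qed

definition family_degree :: "('i \<Rightarrow> 'a set) \<Rightarrow> 'i set \<Rightarrow> 'a \<Rightarrow> nat" where
  "family_degree A I v = card {i \<in> I. v \<in> A i}"

lemma family_degree_le: "finite I \<Longrightarrow> family_degree A I v \<le> card I"
  by (simp add: family_degree_def card_mono)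

lemma sum_card_Diff_eq_sum_family_degree:
  assumes "finite V" "finite I" and A: "\<And>i. i \<in> I \<Longrightarrow> A i \<subseteq> V"
  shows "(\<Sum>(i, j)\<in>I \<times> I. card (A i - A j)) =
    (\<Sum>v\<in>V. family_degree A I v * (card I - family_degree A I v))"
proof -
  have "(\<Sum>v\<in>V. card {p \<in> I \<times> I. v \<in> A (fst p) - A (snd p)}) =
      (\<Sum>p\<in>I \<times> I. card (A (fst p) - A (snd p)))"
  proof (rule sum_multicount_gen)
    show "\<forall>p\<in>I \<times> I. card {v \<in> V. v \<in> A (fst p) - A (snd p)} = card (A (fst p) - A (snd p))"
      using A by (auto intro!: arg_cong[where f = card])
  qed (use assms in auto)
  moreover have "card {p \<in> I \<times> I. v \<in> A (fst p) - A (snd p)} =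
      family_degree A I v * (card I - family_degree A I v)" for v
  proof -
    have "{p \<in> I \<times> I. v \<in> A (fst p) - A (snd p)} = {i \<in> I. v \<in> A i} \<times> (I - {i \<in> I. v \<in> A i})"
      by auto
    then show ?thesis
      using \<open>finite I\<close> by (simp add: family_degree_def card_cartesian_product card_Diff_subset)
  qed
  ultimately show ?thesis by (simp add: case_prod_unfold)
qed

lemma plotkin_bound:
  assumes V: "finite V" and I: "finite I" and A: "\<And>i. i \<in> I \<Longrightarrow> A i \<subseteq> V"
    and dist: "\<And>i j. i \<in> I \<Longrightarrow> j \<in> I \<Longrightarrow> i \<noteq> j \<Longrightarrow> d \<le> card (sym_diff (A i) (A j))"
  shows "card I * (card I - 1) * d \<le> 2 * card V * ((card I)\<^sup>2 div 4)"
proof -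
  have fin: "finite (A i)" if "i \<in> I" for i
    using A[OF that] V by (rule finite_subset)
  have "card I * (card I - 1) * d = (\<Sum>i\<in>I. \<Sum>j\<in>I - {i}. d)"
    using I by simp
  also have "\<dots> \<le> (\<Sum>i\<in>I. \<Sum>j\<in>I - {i}. card (sym_diff (A i) (A j)))"
    by (intro sum_mono dist) auto
  also have "\<dots> \<le> (\<Sum>i\<in>I. \<Sum>j\<in>I. card (sym_diff (A i) (A j)))"
    using I by (intro sum_mono sum_mono2) auto
  also have "\<dots> = (\<Sum>i\<in>I. \<Sum>j\<in>I. card (A i - A j) + card (A j - A i))"
    using fin by (intro sum.cong refl card_Un_disjoint) auto
  also have "\<dots> = 2 * (\<Sum>i\<in>I. \<Sum>j\<in>I. card (A i - A j))"
    using sum.swap[of "\<lambda>i j. card (A j - A i)" I I] by (simp add: sum.distrib)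
  also have "\<dots> = 2 * (\<Sum>v\<in>V. family_degree A I v * (card I - family_degree A I v))"
    using sum_card_Diff_eq_sum_family_degree[OF V I A] by (simp add: sum.cartesian_product)
  also have "\<dots> \<le> 2 * (\<Sum>v\<in>V. (card I)\<^sup>2 div 4)"
    by (intro mult_left_mono sum_mono mult_diff_le_square_div_4 family_degree_le I) simp
  finally show ?thesis by simp
qed

subsection \<open>Decompositions into induced matchings\<close>

definition edge_copies :: "'b set \<Rightarrow> 'a set set \<Rightarrow> ('a \<times> 'b) set set" where
  "edge_copies X M = (\<lambda>(e, x). e \<times> {x}) ` (M \<times> X)"

locale rs_decomposition =
  fixes r t :: nat and V :: "'a set" and M :: "nat \<Rightarrow> 'a set set"
  assumes finite_vertices: "finite V"
    and edge_subset: "i < t \<Longrightarrow> e \<in> M i \<Longrightarrow> e \<subseteq> V"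
    and card_edge: "i < t \<Longrightarrow> e \<in> M i \<Longrightarrow> card e = 2"
    and disjoint_matching: "i < t \<Longrightarrow> disjoint (M i)"
    and card_matching: "i < t \<Longrightarrow> card (M i) = r"
    and edge_separated: "i < t \<Longrightarrow> j < t \<Longrightarrow> e \<in> M i \<Longrightarrow> e \<subseteq> \<Union>(M j) \<Longrightarrow> i = j"
begin

lemma rs_graph_Union: "rs_graph r t V (\<Union>i<t. M i)"
proof -
  have "induced_edges (\<Union>i<t. M i) (\<Union>(M j)) = M j" if "j < t" for j
    using edge_separated that by (fastforce simp: induced_edges_def)
  moreover have "disjoint_family_on M {..<t}"
    unfolding disjoint_family_on_def using edge_separated by blast
  ultimately show ?thesis
    using finite_vertices edge_subset card_edge disjoint_matching card_matching
    unfolding rs_graph_def simple_graph_def induced_matching_def matching_def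
    by (intro conjI exI[of _ M]) auto
qed

lemma Union_matching_subset: "i < t \<Longrightarrow> \<Union>(M i) \<subseteq> V"
  using edge_subset by blast

lemma finite_edge: "i < t \<Longrightarrow> e \<in> M i \<Longrightarrow> finite e"
  using card_edge by (metis card.infinite zero_neq_numeral)

lemma finite_Union_matching: "i < t \<Longrightarrow> finite (\<Union>(M i))"
  using Union_matching_subset finite_vertices finite_subset by blast

lemma finite_matching: "i < t \<Longrightarrow> finite (M i)"
  using finite_Union_matching finite_UnionD by blast

lemma card_Union_matching:
  assumes "i < t"
  shows "card (\<Union>(M i)) = 2 * r"
  using card_partition[of "M i" 2] disjointD[OF disjoint_matching[OF assms]] assms
  by (simp add: finite_matching finite_Union_matching card_edge card_matching)

lemma card_Int_Union_matching_le:
  assumes "i < t" "j < t" "i \<noteq> j"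
  shows "card (\<Union>(M i) \<inter> \<Union>(M j)) \<le> r"
proof -
  have edge: "card (e \<inter> \<Union>(M j)) \<le> 1" if "e \<in> M i" for e
  proof -
    have "e \<inter> \<Union>(M j) \<subset> e" using edge_separated assms that by blast
    then have "card (e \<inter> \<Union>(M j)) < card e"
      by (rule psubset_card_mono[OF finite_edge[OF assms(1) that]])
    then show ?thesis using card_edge[OF assms(1) that] by simp
  qed
  have "card (\<Union>(M i) \<inter> \<Union>(M j)) = card (\<Union>e\<in>M i. e \<inter> \<Union>(M j))"
    by (simp only: Int_Union2)
  also have "\<dots> \<le> (\<Sum>e\<in>M i. card (e \<inter> \<Union>(M j)))"
    by (rule card_UN_le[OF finite_matching[OF assms(1)]])
  also have "\<dots> \<le> of_nat (card (M i)) * 1"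
    by (rule sum_bounded_above[OF edge])
  also have "\<dots> = r"
    by (simp add: card_matching[OF assms(1)])
  finally show ?thesis .
qed

lemma card_sym_diff_Union_matching_ge:
  assumes "i < t" "j < t" "i \<noteq> j"
  shows "2 * r \<le> card (sym_diff (\<Union>(M i)) (\<Union>(M j)))"
proof -
  have Diff_ge: "r \<le> card (\<Union>(M i) - \<Union>(M j))" if "i < t" "j < t" "i \<noteq> j" for i j
    using card_Diff_subset_Int[of "\<Union>(M i)" "\<Union>(M j)"] card_Int_Union_matching_le[OF that]
      card_Union_matching[OF that(1)] finite_Union_matching[OF that(1)] by simp
  have "card (sym_diff (\<Union>(M i)) (\<Union>(M j))) =
      card (\<Union>(M i) - \<Union>(M j)) + card (\<Union>(M j) - \<Union>(M i))"
    using assms finite_Union_matching by (intro card_Un_disjoint) auto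
  then show ?thesis
    using Diff_ge[of i j] Diff_ge[of j i] assms by simp
qed

lemma matching_size_bound: "t * (t + 1) * r \<le> card V * ((t + 1)\<^sup>2 div 4)"
proof -
  define A where "A i = (if i < t then \<Union>(M i) else {})" for i
  have "card {..t} * (card {..t} - 1) * (2 * r) \<le> 2 * card V * ((card {..t})\<^sup>2 div 4)"
  proof (rule plotkin_bound[OF finite_vertices])
    show "A i \<subseteq> V" for i
      using Union_matching_subset by (simp add: A_def)
    show "2 * r \<le> card (sym_diff (A i) (A j))" if "i \<in> {..t}" "j \<in> {..t}" "i \<noteq> j" for i j
      using that card_sym_diff_Union_matching_ge card_Union_matching by (auto simp: A_def)
  qed simp
  then show ?thesis by (simp add: algebra_simps)
qed

lemma image_decomposition:
  assumes inj: "inj_on f V"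
  shows "rs_decomposition r t (f ` V) (\<lambda>i. (`) f ` M i)"
proof
  fix i j e
  assume i: "i < t" and j: "j < t" and "e \<in> (`) f ` M i" "e \<subseteq> \<Union>((`) f ` M j)"
  then obtain d where d: "d \<in> M i" "f ` d \<subseteq> f ` \<Union>(M j)"
    by (auto simp: image_Union)
  then have "d \<subseteq> \<Union>(M j)"
    using inj_onD[OF inj] edge_subset[OF i] Union_matching_subset[OF j] by blast
  then show "i = j" by (rule edge_separated[OF i j d(1)])
next
  fix i assume i: "i < t"
  show "disjoint ((`) f ` M i)"
    by (intro disjoint_image disjoint_matching inj_on_subset[OF inj] Union_matching_subset i)
  have "inj_on ((`) f) (M i)"
    by (rule inj_on_subset[OF inj_on_image_Pow[OF inj]]) (use edge_subset[OF i] in blast)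
  then show "card ((`) f ` M i) = r"
    using card_matching[OF i] by (simp add: card_image)
next
  fix i e assume i: "i < t" and "e \<in> (`) f ` M i"
  then obtain d where d: "d \<in> M i" "e = f ` d" by blast
  then show "e \<subseteq> f ` V" using edge_subset[OF i] by blast
  show "card e = 2"
    using d card_edge[OF i] card_image[OF inj_on_subset[OF inj edge_subset[OF i]]] by simp
qed (simp add: finite_vertices)

lemma copies_decomposition:
  assumes "finite X"
  shows "rs_decomposition (card X * r) t (V \<times> X) (\<lambda>i. edge_copies X (M i))"
proof
  fix i j e
  assume i: "i < t" and j: "j < t"
    and "e \<in> edge_copies X (M i)" "e \<subseteq> \<Union>(edge_copies X (M j))"
  then obtain d where "d \<in> M i" "d \<subseteq> \<Union>(M j)"
    by (fastforce simp: edge_copies_def)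
  then show "i = j" by (rule edge_separated[OF i j])
next
  fix i assume i: "i < t"
  show "disjoint (edge_copies X (M i))"
    by (rule disjointI)
      (use disjointD[OF disjoint_matching[OF i]] in \<open>fastforce simp: edge_copies_def\<close>)
  have "e \<noteq> {}" if "e \<in> M i" for e
    using card_edge[OF i that] by auto
  then have "inj_on (\<lambda>(e, x). e \<times> {x}) (M i \<times> X)"
    by (auto simp: inj_on_def times_eq_iff)
  then show "card (edge_copies X (M i)) = card X * r"
    using card_matching[OF i] by (simp add: edge_copies_def card_image card_cartesian_product)
next
  fix i e assume "i < t" "e \<in> edge_copies X (M i)"
  then show "e \<subseteq> V \<times> X" "card e = 2"
    using edge_subset card_edge by (auto simp: edge_copies_def card_cartesian_product)
qed (simp add: finite_vertices assms)

end

lemma rs_graph_imp_decomposition: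
  assumes "rs_graph r t V E"
  obtains M where "rs_decomposition r t V M"
proof -
  obtain M where graph: "simple_graph V E"
    and matching: "\<And>i. i < t \<Longrightarrow> induced_matching E (M i)" "\<And>i. i < t \<Longrightarrow> card (M i) = r"
    and disj: "disjoint_family_on M {..<t}"
    using assms unfolding rs_graph_def by blast
  have M: "M i \<subseteq> E" "disjoint (M i)" "induced_edges E (\<Union>(M i)) = M i" if "i < t" for i
    using matching(1)[OF that] by (auto simp: induced_matching_def matching_def)
  have "rs_decomposition r t V M"
  proof
    fix i j e assume ij: "i < t" "j < t" and e: "e \<in> M i" "e \<subseteq> \<Union>(M j)"
    then have "e \<in> M j"
      using M(1)[OF ij(1)] M(3)[OF ij(2)] by (auto simp: induced_edges_def)
    then show "i = j"
      using disj ij e(1) by (auto simp: disjoint_family_on_def)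
  qed (use graph M matching(2) in \<open>(fastforce simp: simple_graph_def)+\<close>)
  then show thesis by (rule that)
qed

subsection \<open>The upper bound\<close>

lemma rs_bound_eq:
  "rs_bound n t = real (n * (t div 2 + 1)) / real (2 * (2 * (t div 2) + 1))"
proof (cases "odd t")
  case True
  then obtain k where "t = 2 * k + 1" by (elim oddE)
  then show ?thesis by (simp add: rs_bound_def field_simps)
next
  case False
  then obtain k where "t = 2 * k" by (auto elim: evenE)
  then show ?thesis by (simp add: rs_bound_def field_simps)
qed

lemma le_rs_bound_iff:
  assumes "t \<ge> 1"
  shows "real r \<le> rs_bound n t \<longleftrightarrow> t * (t + 1) * r \<le> n * ((t + 1)\<^sup>2 div 4)"
proof -
  define k where "k = t div 2"
  have "real r \<le> rs_bound n t \<longleftrightarrow> real (r * (2 * (2 * k + 1))) \<le> real (n * (k + 1))"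
    unfolding rs_bound_eq k_def[symmetric] of_nat_mult[of r] by (rule pos_le_divide_eq) simp
  also have "\<dots> \<longleftrightarrow> r * (2 * (2 * k + 1)) \<le> n * (k + 1)"
    by (rule of_nat_le_iff)
  also have "\<dots> \<longleftrightarrow> t * (t + 1) * r \<le> n * ((t + 1)\<^sup>2 div 4)"
  proof (cases "odd t")
    case True
    then have t: "t = 2 * k + 1" by (simp add: k_def)
    have "(t + 1)\<^sup>2 = (k + 1)\<^sup>2 * 4" by (simp add: t power2_eq_square algebra_simps)
    then have "(t + 1)\<^sup>2 div 4 = (k + 1)\<^sup>2" by linarith
    then have "n * ((t + 1)\<^sup>2 div 4) = (k + 1) * (n * (k + 1))"
      by (simp only: power2_eq_square mult.left_commute)
    moreover have "t * (t + 1) * r = (k + 1) * (r * (2 * (2 * k + 1)))"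
      by (simp add: t algebra_simps)
    ultimately show ?thesis by (simp only: mult_le_cancel1) simp
  next
    case False
    then have t: "t = 2 * k" by (simp add: k_def)
    have "(t + 1)\<^sup>2 = 1 + k * (k + 1) * 4" by (simp add: t power2_eq_square algebra_simps)
    then have "(t + 1)\<^sup>2 div 4 = k * (k + 1)" by linarith
    then have "n * ((t + 1)\<^sup>2 div 4) = k * (n * (k + 1))"
      by (simp only: mult.left_commute)
    moreover have "t * (t + 1) * r = k * (r * (2 * (2 * k + 1)))"
      by (simp add: t algebra_simps)
    ultimately show ?thesis using assms t by (simp only: mult_le_cancel1) simp
  qed
  finally show ?thesis .
qed

lemma rs_graph_le_rs_bound:
  assumes "rs_graph r t V E" "t \<ge> 1"
  shows "real r \<le> rs_bound (card V) t"
proof -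
  obtain M where "rs_decomposition r t V M"
    using assms(1) by (rule rs_graph_imp_decomposition)
  then have "t * (t + 1) * r \<le> card V * ((t + 1)\<^sup>2 div 4)"
    by (rule rs_decomposition.matching_size_bound)
  then show ?thesis by (simp only: le_rs_bound_iff[OF assms(2)])
qed

subsection \<open>Consecutive layers of the cube\<close>

definition layer_pair :: "'a set \<Rightarrow> nat \<Rightarrow> 'a set set" where
  "layer_pair U k = {S. S \<subseteq> U \<and> (card S = k \<or> card S = Suc k)}"

definition direction_edges :: "'a set \<Rightarrow> nat \<Rightarrow> 'a \<Rightarrow> 'a set set set" where
  "direction_edges U k i = (\<lambda>S. {S, insert i S}) ` {S. S \<subseteq> U - {i} \<and> card S = k}"

lemma card_layer_pair:
  assumes "finite U"
  shows "card (layer_pair U k) = Suc (card U) choose Suc k"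
proof -
  have "layer_pair U k = {S. S \<subseteq> U \<and> card S = k} \<union> {S. S \<subseteq> U \<and> card S = Suc k}"
    by (auto simp: layer_pair_def)
  also have "card \<dots> = (card U choose k) + (card U choose Suc k)"
    using assms by (subst card_Un_disjoint) (auto simp: n_subsets)
  finally show ?thesis by simp
qed

lemma Union_direction_edges:
  "\<Union>(direction_edges U k i) = {S. S \<subseteq> insert i U \<and> card (S - {i}) = k}"
proof (intro equalityI subsetI)
  fix S assume "S \<in> {S. S \<subseteq> insert i U \<and> card (S - {i}) = k}"
  then have "{S - {i}, insert i (S - {i})} \<in> direction_edges U k i"
    by (auto simp: direction_edges_def)
  moreover have "S \<in> {S - {i}, insert i (S - {i})}" by auto
  ultimately show "S \<in> \<Union>(direction_edges U k i)" by blast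
qed (auto simp: direction_edges_def subset_Diff_insert)

lemma disjoint_direction_edges: "disjoint (direction_edges U k i)"
  by (rule disjointI) (auto simp: direction_edges_def)

lemma card_direction_edges:
  assumes "finite U" "i \<in> U"
  shows "card (direction_edges U k i) = (card U - 1) choose k"
proof -
  have "inj_on (\<lambda>S. {S, insert i S}) {S. S \<subseteq> U - {i} \<and> card S = k}"
    by (auto simp: inj_on_def doubleton_eq_iff)
  then show ?thesis
    using assms by (simp add: direction_edges_def card_image n_subsets)
qed

lemma direction_edges_separated:
  assumes "finite U" and e: "e \<in> direction_edges U k i" "e \<subseteq> \<Union>(direction_edges U k j)"
  shows "i = j"
proof (rule ccontr)
  assume "i \<noteq> j"
  obtain S where S: "S \<subseteq> U - {i}" "card S = k" "e = {S, insert i S}"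
    using e(1) by (auto simp: direction_edges_def)
  then have "finite S" using assms(1) finite_subset by blast
  have lower: "card (S - {j}) = k" and upper: "card (insert i S - {j}) = k"
    using e(2) S(3) by (auto simp: Union_direction_edges)
  have "j \<notin> S"
    using lower S(2) card_Diff1_less[OF \<open>finite S\<close>] by force
  then have "card (insert i S - {j}) = Suc k"
    using \<open>i \<noteq> j\<close> \<open>finite S\<close> S by (simp add: subset_Diff_insert)
  then show False using upper by simp
qed

lemma rs_decomposition_layer_pair:
  assumes "t \<le> n"
  shows "rs_decomposition ((n - 1) choose k) t (layer_pair {..<n} k) (direction_edges {..<n} k)"
proof
  show "finite (layer_pair {..<n} k)" by (simp add: layer_pair_def)
next
  fix i e assume i: "i < t" and "e \<in> direction_edges {..<n} k i"
  then obtain S where S: "S \<subseteq> {..<n} - {i}" "card S = k" "e = {S, insert i S}"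
    by (auto simp: direction_edges_def)
  then have "finite S" "i \<notin> S" by (auto intro: finite_subset)
  then show "e \<subseteq> layer_pair {..<n} k" "card e = 2"
    using S i assms by (auto simp: layer_pair_def card_2_iff)
next
  fix i j e assume "e \<in> direction_edges {..<n} k i" "e \<subseteq> \<Union>(direction_edges {..<n} k j)"
  then show "i = j" by (rule direction_edges_separated[OF finite_lessThan])
qed (use assms in \<open>simp_all add: disjoint_direction_edges card_direction_edges\<close>)

subsection \<open>Tightness\<close>

lemma central_binomial_Suc:
  "(2 * k + 2 choose (k + 1)) * (k + 1) = (2 * k choose k) * (2 * (2 * k + 1))"
proof -
  have "(2 * k + 2 choose (k + 1)) * (k + 1) = 2 * ((k + 1) * (2 * k + 1 choose k))"
    using Suc_times_binomial_eq[of "2 * k + 1" k] by simp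
  also have "2 * k + 1 choose k = 2 * k + 1 choose Suc k"
    using central_binomial_odd[of "2 * k + 1"] by simp
  also have "(k + 1) * (2 * k + 1 choose Suc k) = (2 * k + 1) * (2 * k choose k)"
    using Suc_times_binomial[of k "2 * k"] by simp
  finally show ?thesis by simp
qed

lemma rs_bound_attained:
  fixes t m :: nat
  defines "k \<equiv> t div 2"
  shows "\<exists>(V :: nat set) E r. rs_graph r t V E \<and>
    card V = m * (2 * k + 2 choose (k + 1)) \<and> real r = rs_bound (card V) t"
proof -
  define U where "U = {..<2 * k + 1}"
  define W where "W = layer_pair U k \<times> {..<m}"
  have "rs_decomposition (2 * k choose k) t (layer_pair U k) (direction_edges U k)"
    using rs_decomposition_layer_pair[of t "2 * k + 1" k] by (simp add: U_def k_def)
  then obtain M where M: "rs_decomposition (m * (2 * k choose k)) t W M"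
    using rs_decomposition.copies_decomposition[of _ _ _ _ "{..<m}"] by (fastforce simp: W_def)
  then obtain f :: "nat set \<times> nat \<Rightarrow> nat" where f: "inj_on f W"
    using ex_bij_betw_finite_nat[OF rs_decomposition.finite_vertices] bij_betw_imp_inj_on by blast
  have "card (f ` W) = card (layer_pair U k) * m"
    unfolding card_image[OF f] by (simp add: W_def card_cartesian_product)
  also have "\<dots> = m * (2 * k + 2 choose (k + 1))"
    using card_layer_pair[of U k] by (simp add: U_def del: binomial_Suc_Suc)
  finally have card: "card (f ` W) = m * (2 * k + 2 choose (k + 1))" .
  have "rs_graph (m * (2 * k choose k)) t (f ` W) (\<Union>i<t. (`) f ` M i)"
    using M f by (intro rs_decomposition.rs_graph_Union rs_decomposition.image_decomposition)
  moreover have "real (m * (2 * k choose k)) = rs_bound (card (f ` W)) t"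
  proof -
    have "card (f ` W) * (k + 1) = m * (2 * k choose k) * (2 * (2 * k + 1))"
      unfolding card by (simp only: mult.assoc central_binomial_Suc)
    then show ?thesis
      unfolding rs_bound_eq k_def[symmetric]
      by (simp only: of_nat_mult[of "m * (2 * k choose k)"] nonzero_mult_div_cancel_right) simp
  qed
  ultimately show ?thesis using card by metis
qed

theorem theorem1p1:
  "(\<forall>(V :: 'a set) E n r t. t \<ge> 1 \<and> rs_graph r t V E \<and> card V = n
      \<longrightarrow> real r \<le> rs_bound n t) \<and>
   (\<forall>t\<ge>1. infinite {n. \<exists>(V :: nat set) E r.
      rs_graph r t V E \<and> card V = n \<and> real r = rs_bound n t})"
proof (intro conjI allI impI)
  fix V :: "'a set" and E n r t
  assume "t \<ge> 1 \<and> rs_graph r t V E \<and> card V = n"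
  then show "real r \<le> rs_bound n t"
    using rs_graph_le_rs_bound by blast
next
  fix t :: nat
  let ?N = "{n. \<exists>(V :: nat set) E r. rs_graph r t V E \<and> card V = n \<and> real r = rs_bound n t}"
  define c where "c = 2 * (t div 2) + 2 choose (t div 2 + 1)"
  have "m * c \<in> ?N" for m
    using rs_bound_attained[of t m] unfolding c_def mem_Collect_eq by metis
  then have "range (\<lambda>m. m * c) \<subseteq> ?N" by (rule image_subsetI)
  moreover have "infinite (range (\<lambda>m. m * c))"
    by (simp add: c_def finite_image_iff inj_on_def)
  ultimately show "infinite ?N" by (rule infinite_super)
qed

end
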